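(* Let $\mathcal I=(t,m,n,\mathcal X,\mathcal X^{(S)},R)$ be an instance of the ICCSI problem over $\mathbb F_q$, and let $m'$ be the number of distinct equivalence classes of $[m]$ under the relation $i\equiv j$ if and only if $\mathcal X^{(i)}=\mathcal X^{(j)}$. If $q>m'$ then $$\kappa(\mathcal I)\le\max\{n-d_i:i\in[m]\}.$$
   Context: Notation: $q$ is a prime power, $\mathbb F_q$ the field with $q$ elements, $[m]=\{1,\dots,m\}$; $A_i$ is the $i$-th row of a matrix $A$. Instance: an instance $\mathcal I=(t,m,n,\mathcal X,\mathcal X^{(S)},R)$ of the Index Coding with Coded Side Information (ICCSI) problem consists of positive integers $t,m,n$; subspaces $\mathcal X^{(S)}$ and $\mathcal X^{(i)}$ ($i\in[m]$) of $\mathbb F_q^n$ of dimensions $d_S$ and $d_i$; $\mathcal X=\{A\in\mathbb F_q^{m\times n}:A_i\in\mathcal X^{(i)},\ i\in[m]\}$; and a matrix $R\in\mathbb F_q^{m\times n}$ with rows $R_i\in\mathcal X^{(S)}\setminus\mathcal X^{(i)}$. Min-rank: $\kappa(\mathcal I)=\min\{\operatorname{rank}(A+R):A\in\mathbb F_q^{m\times n},\ A_i\in\mathcal X^{(i)}\cap\mathcal X^{(S)}\ \text{for all } i\in[m]\}$. *)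

theory Defs
  imports "HOL-Analysis.Cartesian_Space"
begin

text \<open>
  The field with \<open>q\<close> elements is a type \<open>'a\<close> of sort \<open>{field, finite}\<close> with \<open>q = CARD('a)\<close>.
  The positive integers \<open>m\<close> and \<open>n\<close> are the cardinalities of the index types \<open>'m\<close> and \<open>'n\<close>;
  thus \<open>'a ^ 'n\<close> is \<open>n\<close>-space, \<open>'a ^ 'n ^ 'm\<close> is the space of \<open>m\<close> by \<open>n\<close> matrices,
  and \<open>A $ i\<close> is the \<open>i\<close>-th row of \<open>A\<close>.
  The constants \<open>vec.subspace\<close> and \<open>vec.dim\<close> refer to scalar multiplication over \<open>'a\<close>.
\<close>

record ('a, 'm, 'n) iccsi =
  block_length :: nat
  side_space :: "'m::finite \<Rightarrow> ('a ^ 'n::finite) set"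
  side_matrices :: "('a ^ 'n ^ 'm) set"
  sender_space :: "('a ^ 'n) set"
  request :: "'a ^ 'n ^ 'm"

definition iccsi_instance :: "('a::{field,finite}, 'm::finite, 'n::finite) iccsi \<Rightarrow> bool" where
  "iccsi_instance I \<longleftrightarrow>
     block_length I > 0 \<and>
     vec.subspace (sender_space I) \<and>
     (\<forall>i. vec.subspace (side_space I i)) \<and>
     side_matrices I = {A. \<forall>i. A $ i \<in> side_space I i} \<and>
     (\<forall>i. request I $ i \<in> sender_space I - side_space I i)"

definition side_dim :: "('a::{field,finite}, 'm::finite, 'n::finite) iccsi \<Rightarrow> 'm \<Rightarrow> nat" where
  "side_dim I i = vec.dim (side_space I i)"

text \<open>
  The set below is finite, and it contains the rank of \<open>request I\<close> when \<open>I\<close> is an instance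
  (take \<open>A = 0\<close>), so \<open>Min\<close> is the actual minimum.
\<close>

definition min_rank :: "('a::{field,finite}, 'm::finite, 'n::finite) iccsi \<Rightarrow> nat" where
  "min_rank I = Min {rank (A + request I) | A. \<forall>i. A $ i \<in> side_space I i \<inter> sender_space I}"

definition same_side_space :: "('a, 'm::finite, 'n::finite) iccsi \<Rightarrow> ('m \<times> 'm) set" where
  "same_side_space I = {(i, j). side_space I i = side_space I j}"

definition num_side_classes :: "('a, 'm::finite, 'n::finite) iccsi \<Rightarrow> nat" where
  "num_side_classes I = card (UNIV // same_side_space I)"

end

theory Submission imports Defs begin

text \<open>
  Fewer than \<open>q\<close> proper subspaces never cover a vector space over a field with \<open>q\<close> elements.
  Hence one vector of the sender space can be chosen outside all the side spaces
  that do not contain the sender space; adjoining it to each of them lowers their codimension by one.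
  After \<open>N = max (n - d\<^sub>i)\<close> steps the chosen vectors \<open>B\<close>, which lie in the sender space,
  generate together with each side space the whole sender space.
  Writing each request as a side information vector plus an element of \<open>span B\<close>
  and cancelling the former leaves a matrix whose rows lie in \<open>span B\<close>.
\<close>

text \<open>For \<open>v\<close> in \<open>S\<close> outside \<open>U\<close>, the translates of
  \<open>S \<inter> U\<close> by the \<open>CARD('a)\<close> multiples of \<open>v\<close> are
  pairwise disjoint and stay inside \<open>S\<close>.\<close>

lemma card_proper_subspace:
  fixes S U :: "('a::{field,finite} ^ 'n::finite) set"
  assumes "vec.subspace S" "vec.subspace U" "\<not> S \<subseteq> U"
  shows "CARD('a) * card (S \<inter> U) \<le> card S"
proof -
  obtain v where v: "v \<in> S" "v \<notin> U" using assms(3) by auto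
  let ?f = "\<lambda>(c::'a, u). u + c *s v"
  have "inj_on ?f (UNIV \<times> (S \<inter> U))"
  proof (rule inj_onI, clarify)
    fix c u d w
    assume u: "u \<in> U" and w: "w \<in> U" and eq: "u + c *s v = w + d *s v"
    have "(d - c) *s v = u - w"
      using eq by (simp add: vec.scale_left_diff_distrib algebra_simps)
    then have mem: "(d - c) *s v \<in> U"
      using vec.subspace_diff[OF assms(2) u w] by simp
    have "d = c"
    proof (rule ccontr)
      assume "d \<noteq> c"
      then have "v = inverse (d - c) *s ((d - c) *s v)" by simp
      then show False using vec.subspace_scale[OF assms(2) mem] v(2) by metis
    qed
    then show "c = d \<and> u = w" using eq by simp
  qed
  moreover have "?f ` (UNIV \<times> (S \<inter> U)) \<subseteq> S"
    using v(1) assms(1) by (auto intro: vec.subspace_add vec.subspace_scale)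
  ultimately have "card ((UNIV :: 'a set) \<times> (S \<inter> U)) \<le> card S"
    by (intro card_inj_on_le) auto
  then show ?thesis by (simp add: card_cartesian_product)
qed

text \<open>Union bound: each \<open>S \<inter> U\<close> holds at most a fraction
  \<open>1 / CARD('a)\<close> of the nonempty set \<open>S\<close>, so fewer than
  \<open>CARD('a)\<close> of them cannot exhaust it.\<close>

lemma few_proper_subspaces_not_cover:
  fixes S :: "('a::{field,finite} ^ 'n::finite) set"
  assumes "vec.subspace S" "card F < CARD('a)"
    and F: "\<And>U. U \<in> F \<Longrightarrow> vec.subspace U \<and> \<not> S \<subseteq> U"
  shows "\<exists>v\<in>S. \<forall>U\<in>F. v \<notin> U"
proof (rule ccontr)
  assume "\<not> ?thesis"
  then have "S = (\<Union>U\<in>F. S \<inter> U)" by auto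
  then have "card S \<le> (\<Sum>U\<in>F. card (S \<inter> U))"
    by (metis card_UN_le finite_class.finite)
  then have "CARD('a) * card S \<le> (\<Sum>U\<in>F. CARD('a) * card (S \<inter> U))"
    by (simp flip: sum_distrib_left)
  also have "\<dots> \<le> (\<Sum>U\<in>F. card S)"
    using F assms(1) by (intro sum_mono card_proper_subspace) auto
  finally have "CARD('a) * card S \<le> card F * card S" by simp
  moreover have "card S > 0"
    using vec.subspace_0[OF assms(1)] by (auto simp: card_gt_0_iff)
  ultimately show False using assms(2) by simp
qed

text \<open>Induction on the codimension bound \<open>N\<close>, with \<open>F\<close> varying
  because each step replaces the subspaces by larger ones.\<close>

lemma common_spanning_complement:
  fixes S :: "('a::{field,finite} ^ 'n::finite) set"
  assumes "vec.subspace S" "card F < CARD('a)"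
    and "\<And>U. U \<in> F \<Longrightarrow> vec.subspace U \<and> CARD('n) \<le> vec.dim U + N"
  shows "\<exists>B\<subseteq>S. card B \<le> N \<and> (\<forall>U\<in>F. S \<subseteq> vec.span (U \<union> B))"
  using assms(2,3)
proof (induction N arbitrary: F)
  case 0
  have "S \<subseteq> vec.span U" if "U \<in> F" for U
  proof -
    have "vec.dim U = CARD('n)"
      using 0(2)[OF that] dim_subset_UNIV_cart_gen[of U] by simp
    then have "vec.span U = UNIV"
      by (metis vec.dim_eq_full vec_dim_card vec.dim_UNIV vec.dimension_def)
    then show ?thesis by simp
  qed
  then show ?case by (intro exI[of _ "{}"]) auto
next
  case (Suc N)
  \<comment> \<open>Members of \<open>F\<close> containing \<open>S\<close> admit no vector of
    \<open>S\<close> outside them, but for them any \<open>B\<close> will do.\<close>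
  define G where "G = {U \<in> F. \<not> S \<subseteq> U}"
  have "card G \<le> card F"
    unfolding G_def by (intro card_mono) auto
  then have cardG: "card G < CARD('a)" using Suc.prems(1) by simp
  moreover have "vec.subspace U \<and> \<not> S \<subseteq> U" if "U \<in> G" for U
    using that Suc.prems(2) by (auto simp: G_def)
  ultimately obtain v where v: "v \<in> S" "\<And>U. U \<in> G \<Longrightarrow> v \<notin> U"
    using few_proper_subspaces_not_cover[OF assms(1)] by metis
  \<comment> \<open>Enlarging may merge subspaces but never creates more, so the bound by
    \<open>CARD('a)\<close> survives.\<close>
  let ?G = "(\<lambda>U. vec.span (insert v U)) ` G"
  have "card ?G < CARD('a)"
    using card_image_le[of G "\<lambda>U. vec.span (insert v U)"] cardG by simp
  moreover have "vec.subspace W \<and> CARD('n) \<le> vec.dim W + N" if "W \<in> ?G" for W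
  proof -
    obtain U where U: "U \<in> G" "W = vec.span (insert v U)" using \<open>W \<in> ?G\<close> by blast
    have "vec.subspace U" "CARD('n) \<le> vec.dim U + Suc N"
      using Suc.prems(2) U(1) by (auto simp: G_def)
    moreover from this have "vec.dim (insert v U) = vec.dim U + 1"
      using v(2)[OF U(1)] by (simp add: vec.dim_insert vec.span_eq_iff[THEN iffD2])
    ultimately show ?thesis using U(2) by simp
  qed
  ultimately obtain B where B: "B \<subseteq> S" "card B \<le> N" "\<And>W. W \<in> ?G \<Longrightarrow> S \<subseteq> vec.span (W \<union> B)"
    using Suc.IH by metis
  have "S \<subseteq> vec.span (U \<union> insert v B)" if "U \<in> F" for U
  proof (cases "S \<subseteq> U")
    case True
    then show ?thesis using vec.span_superset[of "U \<union> insert v B"] by blast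
  next
    case False
    then have "S \<subseteq> vec.span (vec.span (insert v U) \<union> B)"
      using B(3) that by (auto simp: G_def)
    also have "\<dots> \<subseteq> vec.span (U \<union> insert v B)"
    proof (rule vec.span_minimal)
      have "vec.span (insert v U) \<subseteq> vec.span (U \<union> insert v B)"
        by (rule vec.span_mono) auto
      then show "vec.span (insert v U) \<union> B \<subseteq> vec.span (U \<union> insert v B)"
        using vec.span_superset[of "U \<union> insert v B"] by blast
    qed simp
    finally show ?thesis .
  qed
  moreover have "card (insert v B) \<le> Suc N"
    using B(2) card_insert_le_m1[of "Suc N" B v] by simp
  ultimately show ?case using v(1) B(1) by (intro exI[of _ "insert v B"]) auto
qed

text \<open>The classes are the nonempty fibres of \<open>side_space I\<close>, one for each value.
  Equal side spaces thus count once when the family to be avoided is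
  \<open>range (side_space I)\<close>.\<close>

lemma num_side_classes_eq_card_range: "num_side_classes I = card (range (side_space I))"
proof -
  have "same_side_space I `` {i} = side_space I -` {side_space I i}" for i
    by (auto simp: same_side_space_def)
  then have "UNIV // same_side_space I = (\<lambda>X. side_space I -` {X}) ` range (side_space I)"
    by (auto simp: quotient_def)
  moreover have "inj_on (\<lambda>X. side_space I -` {X}) (range (side_space I))"
    by (rule inj_onI) blast
  ultimately show ?thesis by (simp add: num_side_classes_def card_image)
qed

theorem mainTheorem4:
  fixes I :: "('a::{field,finite}, 'm::finite, 'n::finite) iccsi"
  assumes "iccsi_instance I"
    and "CARD('a) > num_side_classes I"
  shows "min_rank I \<le> Max {CARD('n) - side_dim I i | i. i \<in> UNIV}"
proof -
  let ?S = "sender_space I" and ?X = "side_space I" and ?R = "request I"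
  let ?N = "Max {CARD('n) - side_dim I i | i. i \<in> UNIV}"
  have S: "vec.subspace ?S" and X: "\<And>i. vec.subspace (?X i)" and R: "\<And>i. ?R $ i \<in> ?S"
    using assms(1) by (auto simp: iccsi_instance_def)
  have "CARD('n) - side_dim I i \<le> ?N" for i
    by (rule Max_ge) (auto simp: full_SetCompr_eq)
  then have codim: "CARD('n) \<le> vec.dim (?X i) + ?N" for i
    unfolding le_diff_conv side_dim_def by (simp only: add.commute)
  have "\<exists>B\<subseteq>?S. card B \<le> ?N \<and> (\<forall>U\<in>range ?X. ?S \<subseteq> vec.span (U \<union> B))"
    using assms(2) X codim
    by (intro common_spanning_complement[OF S]) (auto simp: num_side_classes_eq_card_range)
  then obtain B where B: "B \<subseteq> ?S" "card B \<le> ?N" "\<And>i. ?S \<subseteq> vec.span (?X i \<union> B)"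
    by blast
  have spanB: "vec.span B \<subseteq> ?S"
    using B(1) S by (rule vec.span_minimal)
  have "\<exists>a. a \<in> ?X i \<inter> ?S \<and> a + ?R $ i \<in> vec.span B" for i
  proof -
    have "?R $ i \<in> vec.span (?X i \<union> B)"
      using B(3) R by blast
    then obtain x b where xb: "?R $ i = x + b" "x \<in> vec.span (?X i)" "b \<in> vec.span B"
      unfolding vec.span_Un by blast
    have "x \<in> ?X i"
      using xb(2) X vec.span_eq_iff by metis
    \<comment> \<open>Here \<open>B \<subseteq> ?S\<close> matters: it puts \<open>b\<close>, hence
      also \<open>x\<close>, in the sender space, as \<open>min_rank\<close> demands of the rows of
      \<open>A\<close>.\<close>
    moreover have "x \<in> ?S"
      using vec.subspace_diff[OF S R[of i], of b] xb spanB by auto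
    ultimately show ?thesis
      using xb vec.subspace_neg[OF X] vec.subspace_neg[OF S] by (intro exI[of _ "- x"]) auto
  qed
  then obtain a where a: "\<And>i. a i \<in> ?X i \<inter> ?S" "\<And>i. a i + ?R $ i \<in> vec.span B"
    by metis
  define A where "A = (\<chi> i. a i)"
  have "rows (A + ?R) \<subseteq> vec.span B"
    using a(2) by (auto simp: rows_def row_def A_def plus_vec_def)
  \<comment> \<open>Rank is read as row rank, the dimension of a set of rows spanned by
    \<open>B\<close>.\<close>
  then have "rank (A + ?R) \<le> card B"
    unfolding row_rank_def_gen by (rule vec.dim_le_card) simp
  moreover have "min_rank I \<le> rank (A + ?R)"
    unfolding min_rank_def using a(1) by (intro Min_le) (auto simp: A_def)
  ultimately show ?thesis using B(2) by simp
qed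

end
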